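(* For every partition $\lambda$ with conjugate partition $\lambda'$, the involution $\omega$ of $\Lambda$ satisfies $$\omega(sp_\lambda)=o_{\lambda'}.$$
   Context: $\Lambda=\Lambda_{\mathbb Q}=\mathbb Q[p_1,p_2,\dots]$ is the ring of symmetric functions over $\mathbb Q$ in countably many variables, where $p_n=\sum_i x_i^n$ are the power sums. $\omega:\Lambda\to\Lambda$ is the $\mathbb Q$-algebra involution with $\omega(p_n)=(-1)^{n-1}p_n$. $h_n$ is the complete homogeneous symmetric function, $\sum_{n\ge0}h_nz^n=\exp(\sum_{n\ge1}\frac{p_n}{n}z^n)$, with $h_n=0$ for $n<0$. For a partition $\lambda=(\lambda_1\ge\dots\ge\lambda_k\ge0)$ with $k\ge1$ (trailing zeros allowed; the empty partition is written $(0)$), the symplectic and orthogonal Schur functions are $$sp_\lambda=\tfrac12\det(h_{\lambda_i-i+j}+h_{\lambda_i-i-j+2})_{1\le i,j\le k},\qquad o_\lambda=\det(h_{\lambda_i-i+j}-h_{\lambda_i-i-j})_{1\le i,j\le k}.$$ *)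

theory Defs
  imports
    "HOL-Library.Poly_Mapping"
    "HOL-Computational_Algebra.Formal_Power_Series"
    "Jordan_Normal_Form.Determinant"
begin

section \<open>The ring of symmetric functions over the rationals\<close>

text \<open>
  The ring \<open>\<Lambda> = \<rat>[p\<^sub>1, p\<^sub>2, \<dots>]\<close> is the polynomial ring over the rationals in the
  countably many indeterminates \<open>p\<^sub>1, p\<^sub>2, \<dots>\<close>. An exponent vector is a finitely supported
  function from \<open>nat\<close> to \<open>nat\<close>, in which position \<open>i\<close> holds the exponent of
  \<open>p\<^bsub>i+1\<^esub>\<close>; every natural number thus indexes an indeterminate.
\<close>

type_synonym symfun = "(nat \<Rightarrow>\<^sub>0 nat) \<Rightarrow>\<^sub>0 rat"

definition scalar :: "rat \<Rightarrow> symfun" where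
  "scalar c = Poly_Mapping.single 0 c"

text \<open>Meaningful for \<open>n \<ge> 1\<close> only.\<close>

definition power_sum :: "nat \<Rightarrow> symfun" where
  "power_sum n = Poly_Mapping.single (Poly_Mapping.single (n - 1) 1) 1"

text \<open>
  \<open>\<omega>\<close> substitutes \<open>(-1)\<^bsup>n-1\<^esup> p\<^sub>n\<close> for every indeterminate \<open>p\<^sub>n\<close>;
  below, \<open>n = i + 1\<close>.
\<close>

definition omega :: "symfun \<Rightarrow> symfun" where
  "omega f = (\<Sum>m\<in>Poly_Mapping.keys f. scalar (Poly_Mapping.lookup f m) *
     (\<Prod>i\<in>Poly_Mapping.keys m. ((-1) ^ i * power_sum (i + 1)) ^ Poly_Mapping.lookup m i))"

text \<open>
  \<open>H(z) = exp (\<Sum>\<^bsub>n\<ge>1\<^esub> p\<^sub>n z\<^sup>n / n)\<close>. The exponential series is written out because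
  \<open>fps_exp\<close> is confined to coefficients in a field.
\<close>

definition complete_series :: "symfun fps" where
  "complete_series =
     Abs_fps (\<lambda>k. scalar (1 / fact k)) oo
     Abs_fps (\<lambda>n. if n = 0 then 0 else scalar (1 / of_nat n) * power_sum n)"

definition complete :: "int \<Rightarrow> symfun" where
  "complete n = (if n < 0 then 0 else fps_nth complete_series (nat n))"


section \<open>Partitions\<close>

text \<open>
  A partition is given by a nonempty weakly decreasing list of parts, in which trailing zeros
  are allowed; the empty partition is represented by \<open>[0]\<close>, \<open>[0, 0]\<close> and so on.
\<close>

definition is_partition :: "nat list \<Rightarrow> bool" where
  "is_partition lam \<longleftrightarrow> lam \<noteq> [] \<and> sorted_wrt (\<ge>) lam"

text \<open>
  \<open>\<lambda>'\<^sub>j = |{i. \<lambda>\<^sub>i \<ge> j}|\<close> for all \<open>j \<ge> 1\<close>, shifted to indices from \<open>0\<close>. As a relation on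
  lists, it leaves the number of trailing zeros in \<open>mu\<close> unconstrained.
\<close>

definition is_conjugate :: "nat list \<Rightarrow> nat list \<Rightarrow> bool" where
  "is_conjugate mu lam \<longleftrightarrow>
     (\<forall>j. nth_default 0 mu j = card {i. i < length lam \<and> lam ! i \<ge> j + 1})"


section \<open>Symplectic and orthogonal Schur functions\<close>

text \<open>Matrix positions \<open>(a, b)\<close> count from \<open>0\<close>, hence \<open>i = a + 1\<close> and \<open>j = b + 1\<close>.\<close>

definition sp_schur :: "nat list \<Rightarrow> symfun" where
  "sp_schur lam = scalar (1 / 2) * det (mat (length lam) (length lam) (\<lambda>(a, b).
     let i = int a + 1; j = int b + 1 in
       complete (int (lam ! a) - i + j) + complete (int (lam ! a) - i - j + 2)))"

definition o_schur :: "nat list \<Rightarrow> symfun" where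
  "o_schur lam = det (mat (length lam) (length lam) (\<lambda>(a, b).
     let i = int a + 1; j = int b + 1 in
       complete (int (lam ! a) - i + j) - complete (int (lam ! a) - i - j)))"


section \<open>Basic facts\<close>

definition omega_monom :: "(nat \<Rightarrow>\<^sub>0 nat) \<Rightarrow> symfun" where
  "omega_monom m = (\<Prod>i\<in>Poly_Mapping.keys m. ((-1) ^ i * power_sum (i + 1)) ^ Poly_Mapping.lookup m i)"

lemma omega_altdef: "omega f = (\<Sum>m\<in>Poly_Mapping.keys f. scalar (Poly_Mapping.lookup f m) * omega_monom m)"
  by (simp add: omega_def omega_monom_def)

lemma omega_superset:
  assumes "finite A" "Poly_Mapping.keys f \<subseteq> A"
  shows "omega f = (\<Sum>m\<in>A. scalar (Poly_Mapping.lookup f m) * omega_monom m)"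
  unfolding omega_altdef using assms
  by (intro sum.mono_neutral_left) (auto simp: in_keys_iff scalar_def)

lemma omega_monom_superset:
  assumes "finite A" "Poly_Mapping.keys m \<subseteq> A"
  shows "omega_monom m = (\<Prod>i\<in>A. ((-1) ^ i * power_sum (i + 1)) ^ Poly_Mapping.lookup m i)"
  unfolding omega_monom_def using assms
  by (intro prod.mono_neutral_left) (auto simp: in_keys_iff)

lemma omega_monom_add: "omega_monom (m + n) = omega_monom m * omega_monom n"
proof -
  let ?A = "Poly_Mapping.keys m \<union> Poly_Mapping.keys n"
  have "Poly_Mapping.keys (m + n) \<subseteq> ?A" by (rule keys_add)
  then show ?thesis
    by (simp add: omega_monom_superset[of ?A] lookup_add power_add prod.distrib)
qed

lemma scalar_add: "scalar (a + b) = scalar a + scalar b"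
  by (simp add: scalar_def single_add)

lemma scalar_mult: "scalar (a * b) = scalar a * scalar b"
  by (simp add: scalar_def mult_single)

lemma omega_add: "omega (f + g) = omega f + omega g"
proof -
  let ?A = "Poly_Mapping.keys f \<union> Poly_Mapping.keys g"
  have "Poly_Mapping.keys (f + g) \<subseteq> ?A" by (rule keys_add)
  then show ?thesis
    by (simp add: omega_superset[of ?A] lookup_add scalar_add distrib_right sum.distrib)
qed

lemma omega_zero: "omega 0 = 0"
  by (simp add: omega_def)

lemma omega_single: "omega (Poly_Mapping.single m c) = scalar c * omega_monom m"
  by (simp add: omega_altdef scalar_def)

lemma omega_scalar: "omega (scalar c) = scalar c"
  unfolding scalar_def[of c] omega_single by (simp add: omega_monom_def scalar_def)

lemma symfun_induct [case_names zero add]: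
  fixes f :: symfun
  assumes "P 0" "\<And>m c g. P g \<Longrightarrow> P (Poly_Mapping.single m c + g)"
  shows "P f"
proof -
  have "P (\<Sum>m\<in>A. Poly_Mapping.single m (Poly_Mapping.lookup f m))" if "finite A" for A
    using that by (induction A rule: finite_induct) (auto simp: assms)
  moreover have "f = (\<Sum>m\<in>Poly_Mapping.keys f. Poly_Mapping.single m (Poly_Mapping.lookup f m))"
    by (rule poly_mapping_eqI)
       (auto simp: lookup_sum lookup_single when_def in_keys_iff)
  ultimately show ?thesis by (metis finite_keys)
qed

lemma omega_mult: "omega (f * g) = omega f * omega g"
proof (induction f rule: symfun_induct)
  case (add m c f)
  have "omega (Poly_Mapping.single m c * g) = omega (Poly_Mapping.single m c) * omega g"
    by (induction g rule: symfun_induct)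
       (simp_all add: omega_zero omega_add omega_single distrib_left mult_single
          omega_monom_add scalar_mult mult_ac)
  with add show ?case by (simp add: distrib_right omega_add)
qed (simp add: omega_zero)

lemma omega_power_sum: "n \<ge> 1 \<Longrightarrow> omega (power_sum n) = (-1) ^ (n - 1) * power_sum n"
  by (simp add: power_sum_def[of n] omega_single scalar_def omega_monom_def)

lemma conjugate_exists:
  assumes "is_partition lam"
  shows "\<exists>mu. is_partition mu \<and> is_conjugate mu lam"
proof -
  define c where "c j = card {i. i < length lam \<and> lam ! i \<ge> j + 1}" for j
  define mu where "mu = map c [0..<Suc (sum_list lam)]"
  have anti: "c j \<le> c i" if "i \<le> j" for i j
    unfolding c_def using that by (intro card_mono) auto
  have zero: "c j = 0" if "j \<ge> sum_list lam" for j
    unfolding c_def using that member_le_sum_list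
    by (force dest: nth_mem)
  have "sorted_wrt (\<ge>) mu"
    unfolding mu_def sorted_wrt_map
    by (rule sorted_wrt_mono_rel[OF _ sorted_wrt_upt]) (auto intro: anti)
  moreover have "mu \<noteq> []" by (simp add: mu_def)
  moreover have "nth_default 0 mu j = c j" for j
    by (auto simp: mu_def nth_default_def zero simp del: upt_Suc)
  ultimately show ?thesis
    unfolding is_partition_def is_conjugate_def c_def by blast
qed

end

theory Submission
  imports Defs
begin

text \<open>
  Put \<open>e\<^sub>n = \<omega>(h\<^sub>n)\<close>. Since \<open>\<omega>\<close> turns \<open>H(z)\<close> into \<open>1 / H(-z)\<close>, the sequences \<open>h\<close> and \<open>e\<close> are
  inverse to each other up to signs, which makes the columns \<open>r \<mapsto> h\<^bsub>r+d\<^esub> + h\<^bsub>r-d\<^esub>\<close> with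
  \<open>0 \<le> d < k\<close> orthogonal to the rows \<open>r \<mapsto> (-1)\<^sup>r (e\<^bsub>j-r\<^esub> - e\<^bsub>-j-r\<^esub>)\<close> with \<open>1 \<le> j \<le> l\<close>, where
  \<open>-k < r \<le> l\<close>. Complementary maximal minors of these two families therefore agree up to sign, as in
  Jacobi's theorem on minors of an inverse matrix. The sets \<open>{\<lambda>\<^sub>i - i + 1}\<close> and
  \<open>{j - \<lambda>'\<^sub>j}\<close> are complementary, and the corresponding minors are the two determinants. As the
  relation between \<open>h\<close> and \<open>e\<close> is symmetric, \<open>h\<close> and \<open>e\<close> may be exchanged.
\<close>

section \<open>Determinants\<close>

lemma det_block_lower:
  fixes f :: "nat \<times> nat \<Rightarrow> 'a::idom"
  assumes "\<And>i j. i < k \<Longrightarrow> j < l \<Longrightarrow> f (i, k + j) = 0"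
  shows "det (mat (k + l) (k + l) f) =
    det (mat k k f) * det (mat l l (\<lambda>(i, j). f (k + i, k + j)))"
proof -
  have "mat (k + l) (k + l) f = four_block_mat (mat k k f) (0\<^sub>m k l)
      (mat l k (\<lambda>(i, j). f (k + i, j))) (mat l l (\<lambda>(i, j). f (k + i, k + j)))"
    using assms by (intro eq_matI) (auto simp: not_less le_iff_add)
  then show ?thesis
    by (simp add: det_four_block_mat_upper_right_zero[of _ k _ l])
qed

lemma det_block_upper:
  fixes f :: "nat \<times> nat \<Rightarrow> 'a::idom"
  assumes "\<And>i j. i < l \<Longrightarrow> j < k \<Longrightarrow> f (k + i, j) = 0"
  shows "det (mat (k + l) (k + l) f) =
    det (mat k k f) * det (mat l l (\<lambda>(i, j). f (k + i, k + j)))"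
proof -
  have "mat (k + l) (k + l) f = four_block_mat (mat k k f) (mat k l (\<lambda>(i, j). f (i, k + j)))
      (0\<^sub>m l k) (mat l l (\<lambda>(i, j). f (k + i, k + j)))"
    using assms by (intro eq_matI) (auto simp: not_less le_iff_add)
  then show ?thesis
    by (simp add: det_four_block_mat_lower_left_zero[of _ k _ l])
qed

lemma det_lower_triangular_mat:
  fixes f :: "nat \<times> nat \<Rightarrow> 'a::comm_ring_1"
  assumes "\<And>i j. i < j \<Longrightarrow> j < n \<Longrightarrow> f (i, j) = 0"
  shows "det (mat n n f) = (\<Prod>i<n. f (i, i))"
  using assms det_lower_triangular[of n "mat n n f"]
  by (simp add: prod_list_diag_prod lessThan_atLeast0)

lemma det_mat_transpose:
  fixes f :: "nat \<times> nat \<Rightarrow> 'a::comm_ring_1"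
  shows "det (mat n n (\<lambda>(i, j). f (j, i))) = det (mat n n f)"
proof -
  have "mat n n (\<lambda>(i, j). f (j, i)) = transpose_mat (mat n n f)"
    by (intro eq_matI) auto
  then show ?thesis by (simp add: det_transpose[of _ n])
qed

lemma det_scale_rows:
  fixes f :: "nat \<times> nat \<Rightarrow> 'a::comm_ring_1"
  shows "det (mat n n (\<lambda>(i, j). c i * f (i, j))) = (\<Prod>i<n. c i) * det (mat n n f)"
proof -
  have "(\<Prod>i = 0..<n. mat n n (\<lambda>(i, j). c i * f (i, j)) $$ (i, p i)) =
      (\<Prod>i<n. c i) * (\<Prod>i = 0..<n. mat n n f $$ (i, p i))"
    if "p permutes {0..<n}" for p
    unfolding lessThan_atLeast0 prod.distrib[symmetric]
    using permutes_in_image[OF that] by (intro prod.cong) auto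
  then show ?thesis
    by (simp add: det_def'[of _ n] sum_distrib_left mult.left_commute)
qed

lemma det_scale_columns:
  fixes f :: "nat \<times> nat \<Rightarrow> 'a::comm_ring_1"
  shows "det (mat n n (\<lambda>(i, j). c j * f (i, j))) = (\<Prod>j<n. c j) * det (mat n n f)"
  using det_scale_rows[of n c "\<lambda>(i, j). f (j, i)"]
    det_mat_transpose[of n "\<lambda>(i, j). c j * f (i, j)"] det_mat_transpose[of n f] by simp

text \<open>Reversing the rows and reversing the columns contribute the same sign, and its square is
  1.\<close>

lemma det_reverse:
  fixes f :: "nat \<times> nat \<Rightarrow> 'a::comm_ring_1"
  shows "det (mat n n (\<lambda>(i, j). f (n - 1 - i, n - 1 - j))) = det (mat n n f)"
proof -
  define p where "p i = (if i < n then n - 1 - i else i)" for i :: nat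
  have p: "p permutes {0..<n}"
    by (rule bij_imp_permutes, rule bij_betw_byWitness[where f' = p]) (auto simp: p_def)
  have rows: "det (mat n n (\<lambda>(i, j). g (n - 1 - i, j))) = signof p * det (mat n n g)"
    for g :: "nat \<times> nat \<Rightarrow> 'a"
  proof -
    have "mat n n (\<lambda>(i, j). g (n - 1 - i, j)) = mat n n (\<lambda>(i, j). mat n n g $$ (p i, j))"
      by (intro eq_matI) (auto simp: p_def)
    then show ?thesis using det_permute_rows[of "mat n n g" n p] p by simp
  qed
  have "det (mat n n (\<lambda>(i, j). f (n - 1 - i, n - 1 - j))) =
      signof p * det (mat n n (\<lambda>(i, j). f (i, n - 1 - j)))"
    using rows[of "\<lambda>(i, j). f (i, n - 1 - j)"] by simp
  also have "det (mat n n (\<lambda>(i, j). f (i, n - 1 - j))) =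
      det (mat n n (\<lambda>(i, j). f (j, n - 1 - i)))"
    using det_mat_transpose[of n "\<lambda>(i, j). f (j, n - 1 - i)"] by simp
  also have "\<dots> = signof p * det (mat n n f)"
    using rows[of "\<lambda>(i, j). f (j, i)"] det_mat_transpose[of n f] by simp
  also have "signof p * (signof p * det (mat n n f)) = det (mat n n f)"
    by (simp add: sign_def)
  finally show ?thesis .
qed

text \<open>Laplace expansion along the unit columns, last one first, deletes the rows
  \<open>t b\<close>. Since \<open>s\<close> and \<open>t\<close> enumerate complementary sets of
  rows in increasing order, the minor of \<open>f\<close> in the rows \<open>s a\<close> remains.
  Each factor of the product is one cofactor sign.\<close>

lemma det_unit_columns:
  fixes f :: "nat \<Rightarrow> nat \<Rightarrow> 'a::comm_ring_1"
  assumes "strict_mono_on {..<k} s" "strict_mono_on {..<l} t"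
    and "s ` {..<k} \<subseteq> {..<k + l}" "t ` {..<l} \<subseteq> {..<k + l}"
    and "s ` {..<k} \<inter> t ` {..<l} = {}"
  shows "det (mat (k + l) (k + l) (\<lambda>(p, c). if c < k then f p c else if p = t (c - k) then 1 else 0)) =
    (\<Prod>b<l. (-1) ^ (t b + k + b)) * det (mat k k (\<lambda>(a, c). f (s a) c))"
  using assms
proof (induction l arbitrary: f s)
  case 0
  \<comment> \<open>A strictly increasing self-map of \<open>{..<k}\<close> is the identity:
    \<open>lo\<close> bounds it from below by induction from 0, \<open>hi\<close> from above by
    induction down from \<open>k - 1\<close>.\<close>
  have "s a = a" if "a < k" for a
  proof -
    have lo: "a \<le> s a" if "a < k" for a
      using that
    proof (induction a)
      case (Suc a)
      have "s a < s (Suc a)" using Suc.prems 0(1) by (auto simp: strict_mono_on_def)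
      with Suc show ?case by simp
    qed simp
    have hi: "s a + (k - 1 - a) \<le> k - 1" if "a < k" for a
    proof -
      have "s (k - 1 - d) + d \<le> k - 1" if "d < k" for d
        using that
      proof (induction d)
        case 0
        then have "s (k - 1) \<in> {..<k}"
            using subsetD[OF \<open>s ` {..<k} \<subseteq> {..<k + 0}\<close> imageI[of "k - 1"]] by simp
        then show ?case by auto
      next
        case (Suc d)
        have "s (k - 1 - Suc d) < s (k - 1 - d)"
          using Suc.prems 0(1) by (auto simp: strict_mono_on_def)
        with Suc show ?case by simp
      qed
      from this[of "k - 1 - a"] that show ?thesis by simp
    qed
    from lo[OF that] hi[OF that] that show ?thesis by simp
  qed
  then have "mat k k (\<lambda>(a, c). f (s a) c) = mat k k (\<lambda>(p, c). f p c)"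
    by (intro eq_matI) auto
  moreover have "mat (k + 0) (k + 0) (\<lambda>(p, c). if c < k then f p c else if p = t (c - k) then 1 else 0)
    = mat k k (\<lambda>(p, c). f p c)"
    by (intro eq_matI) auto
  ultimately show ?case by simp
next
  case (Suc l)
  let ?M = "mat (k + Suc l) (k + Suc l)
    (\<lambda>(p, c). if c < k then f p c else if p = t (c - k) then 1 else 0)"
  \<comment> \<open>\<open>f'\<close> is \<open>f\<close> with row \<open>t l\<close> deleted, and
    \<open>s'\<close> renumbers \<open>s\<close> accordingly. As \<open>t l\<close> is the largest
    value of \<open>t\<close>, the other \<open>t b\<close> keep their row numbers.\<close>
  define f' where "f' p = f (if p < t l then p else Suc p)" for p
  define s' where "s' a = (if s a < t l then s a else s a - 1)" for a
  have tl: "t l < k + Suc l" using Suc.prems(4) by auto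
  have tb: "t b < t l" if "b < l" for b
    using that Suc.prems(2) by (auto simp: strict_mono_on_def)
  have sne: "s a \<noteq> t b" if "a < k" "b < Suc l" for a b
    using Suc.prems(5) that by auto
  have sb: "s a < k + Suc l" if "a < k" for a using Suc.prems(3) that by auto
  have s'1: "strict_mono_on {..<k} s'"
  proof (rule strict_mono_onI)
    fix a b assume ab: "a \<in> {..<k}" "b \<in> {..<k}" "a < b"
    then have "s a < s b" using Suc.prems(1) by (auto simp: strict_mono_on_def)
    then show "s' a < s' b" using sne[of a l] sne[of b l] ab by (auto simp: s'_def)
  qed
  have s'2: "s' ` {..<k} \<subseteq> {..<k + l}"
    using sb tl sne[of _ l] by (force simp: s'_def)
  have s'3: "s' ` {..<k} \<inter> t ` {..<l} = {}"
  proof -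
    have "s' a \<noteq> t b" if "a < k" "b < l" for a b
      using sne[of a b] sne[of a l] tb[of b] that by (auto simp: s'_def)
    then show ?thesis by auto
  qed
  have t1: "strict_mono_on {..<l} t" using Suc.prems(2) by (auto simp: strict_mono_on_def)
  have t2: "t ` {..<l} \<subseteq> {..<k + l}" using tb tl by fastforce
  have "det ?M = (\<Sum>i<k + Suc l. ?M $$ (i, k + l) * cofactor ?M i (k + l))"
    by (rule laplace_expansion_column) auto
  also have "\<dots> = (\<Sum>i<k + Suc l. if i = t l then cofactor ?M i (k + l) else 0)"
    by (intro sum.cong) auto
  also have "\<dots> = cofactor ?M (t l) (k + l)" using tl by simp
  also have "\<dots> = (-1) ^ (t l + k + l) * det (mat_delete ?M (t l) (k + l))"
    by (simp add: cofactor_def add.assoc)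
  also have "mat_delete ?M (t l) (k + l) = mat (k + l) (k + l)
      (\<lambda>(p, c). if c < k then f' p c else if p = t (c - k) then 1 else 0)"
    unfolding mat_delete_def
  proof (intro eq_matI, goal_cases)
    case (1 i j)
    then have "j < k \<or> j - k < l" by auto
    with 1 show ?case using tb[of "j - k"] by (cases "j < k") (auto simp: f'_def)
  qed auto
  also have "det \<dots> = (\<Prod>b<l. (-1) ^ (t b + k + b)) * det (mat k k (\<lambda>(a, c). f' (s' a) c))"
    by (rule Suc.IH[OF s'1 t1 s'2 t2 s'3])
  also have "mat k k (\<lambda>(a, c). f' (s' a) c) = mat k k (\<lambda>(a, c). f (s a) c)"
  proof (intro eq_matI, goal_cases)
    case (1 a c)
    then show ?case using sne[of a l] by (auto simp: f'_def s'_def)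
  qed auto
  finally show ?case by (simp add: mult_ac)
qed

section \<open>Symplectic and orthogonal determinants\<close>

text \<open>All nonzero terms have \<open>y \<le> p \<le> x\<close> and so lie in the window;
  shifting \<open>p\<close> by \<open>y\<close> gives the convolution, up to the sign
  \<open>(-1) ^ y\<close>. A negative \<open>x\<close>, which occurs for the reflected index -j-r,
  makes both sides vanish.\<close>

lemma convolution_window:
  fixes h e :: "int \<Rightarrow> 'a::comm_ring_1"
  assumes h0: "\<And>n. n < 0 \<Longrightarrow> h n = 0" and e0: "\<And>n. n < 0 \<Longrightarrow> e n = 0"
    and conv: "\<And>n. (\<Sum>i\<le>n. (-1) ^ i * h (int i) * e (int n - int i)) = (if n = 0 then 1 else 0)"
    and x: "x < int N"
  shows "(\<Sum>p<N. (-1) ^ p * e (x - int p) * h (int p - int y)) = (if x = int y then (-1) ^ y else 0)"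
proof (cases "x < int y")
  case True
  then have "(-1) ^ p * e (x - int p) * h (int p - int y) = 0" for p
    using h0[of "int p - int y"] e0[of "x - int p"] by (cases "p < y") auto
  with True show ?thesis by simp
next
  case False
  define n where "n = nat x - y"
  have nx: "x = int (n + y)" using False by (simp add: n_def)
  have "(\<Sum>p<N. (-1) ^ p * e (x - int p) * h (int p - int y)) =
      (\<Sum>p\<in>{y..n + y}. (-1) ^ p * e (x - int p) * h (int p - int y))"
    using x nx by (intro sum.mono_neutral_right) (auto simp: h0 e0 not_le)
  also have "\<dots> = (\<Sum>i\<le>n. (-1) ^ (i + y) * e (x - int (i + y)) * h (int (i + y) - int y))"
    by (rule sum.reindex_bij_witness[of _ "\<lambda>i. i + y" "\<lambda>p. p - y"]) auto
  also have "\<dots> = (-1) ^ y * (\<Sum>i\<le>n. (-1) ^ i * h (int i) * e (int n - int i))"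
    unfolding sum_distrib_left
    by (intro sum.cong) (auto simp: nx power_add mult_ac of_nat_diff)
  finally show ?thesis using nx conv[of n] by simp
qed

text \<open>\<open>dual\<close> expresses that \<open>L\<close> and \<open>M\<close> are conjugate
  shapes inside a rectangle with k rows and l columns. With \<open>h\<close> and \<open>e\<close>
  abstract, their roles can be exchanged. Halving the column \<open>c = 0\<close> absorbs the factor
  1/2 of the symplectic Schur function.\<close>

lemma symplectic_orthogonal_det:
  fixes h e :: "int \<Rightarrow> 'a::idom" and L M :: "nat \<Rightarrow> nat"
  assumes h0: "\<And>n. n < 0 \<Longrightarrow> h n = 0" "h 0 = 1" and e0: "\<And>n. n < 0 \<Longrightarrow> e n = 0" "e 0 = 1"
    and conv: "\<And>n. (\<Sum>i\<le>n. (-1) ^ i * h (int i) * e (int n - int i)) = (if n = 0 then 1 else 0)"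
    and Lmono: "\<And>a b. a < b \<Longrightarrow> b < k \<Longrightarrow> L b \<le> L a" and Mmono: "\<And>a b. a < b \<Longrightarrow> b < l \<Longrightarrow> M b \<le> M a"
    and Lle: "\<And>a. a < k \<Longrightarrow> L a \<le> l" and Mle: "\<And>b. b < l \<Longrightarrow> M b \<le> k"
    and dual: "\<And>a b. a < k \<Longrightarrow> b < l \<Longrightarrow> a < M b \<longleftrightarrow> b < L a"
  shows "det (mat k k (\<lambda>(a, c). if c = 0 then h (int (L a) - int a)
           else h (int (L a) - int a + int c) + h (int (L a) - int a - int c))) =
         det (mat l l (\<lambda>(a, b). e (int (M a) - int a + int b) - e (int (M a) - int a - int b - 2)))"
    (is "?sp = ?o")
proof -
  \<comment> \<open>In the notation of the introduction \<open>r = p - (k - 1)\<close>, \<open>d = k - 1 - c\<close> and \<open>j = b + 1\<close>;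
    reversing the order of the \<open>d\<close> makes the top block of \<open>F\<close> lower unitriangular.
    The column \<open>d = 0\<close> is halved.\<close>
  define F where "F p c = (if c = k - 1 then h (int p - int c)
    else h (int p - int c) + h (int p - int (2 * (k - 1) - c)))" for p c
  define G where "G b p = (-1) ^ p * (e (int (b + k) - int p) - e (int k - 2 - int b - int p))" for b p
  \<comment> \<open>In the coordinate \<open>p\<close>, \<open>s\<close> and \<open>t\<close> list
    the sets {\<lambda>_i - i + 1} and {j - \<lambda>'_j} in increasing order; hence the reversed
    index in \<open>s\<close>. The subtraction in \<open>t\<close> is exact because
    \<open>M b \<le> k\<close>.\<close>
  define s where "s a = L (k - 1 - a) + a" for a
  define t where "t b = k + b - M b" for b
  \<comment> \<open>The unit columns of \<open>X\<close> single out the minor of \<open>F\<close> in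
    the rows \<open>s a\<close>. In \<open>Y * X\<close> they select the columns \<open>t b\<close>
    of \<open>G\<close>, while \<open>G\<close> annihilates \<open>F\<close>. Evaluating
    \<open>det (Y * X)\<close> in two ways relates the two minors.\<close>
  define X where "X = mat (k + l) (k + l)
    (\<lambda>(p, c). if c < k then F p c else if p = t (c - k) then 1 else 0)"
  define Y where "Y = mat (k + l) (k + l)
    (\<lambda>(q, p). if q < k then if p = q then 1 else 0 else G (q - k) p)"
  \<comment> \<open>The sign of \<open>det X\<close> is split so that \<open>ck\<close> equals
    \<open>det Y\<close> and \<open>sg\<close> is the sign coming out of the columns of
    \<open>G\<close>; both then cancel.\<close>
  define sg :: 'a where "sg = (\<Prod>b<l. (-1) ^ t b)"
  define ck :: 'a where "ck = (\<Prod>b<l. (-1) ^ (k + b))"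
  have t_less: "t b < k + l" if "b < l" for b using that by (auto simp: t_def)
  have GF: "(\<Sum>p<k + l. G b p * F p c) = 0" if b: "b < l" and c: "c < k" for b c
  proof -
    have win: "(\<Sum>p<k + l. G b p * h (int p - int y)) =
        (if b + k = y then (-1) ^ y else 0) - (if int k - 2 - int b = int y then (-1) ^ y else 0)" for y
    proof -
      have "(\<Sum>p<k + l. G b p * h (int p - int y)) =
          (\<Sum>p<k + l. (-1) ^ p * e (int (b + k) - int p) * h (int p - int y)) -
          (\<Sum>p<k + l. (-1) ^ p * e (int k - 2 - int b - int p) * h (int p - int y))"
        by (simp add: G_def algebra_simps sum_subtractf)
      also have "(\<Sum>p<k + l. (-1) ^ p * e (int (b + k) - int p) * h (int p - int y)) =
          (if int (b + k) = int y then (-1) ^ y else 0)"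
        by (rule convolution_window[OF h0(1) e0(1) conv]) (use b in auto)
      also have "(\<Sum>p<k + l. (-1) ^ p * e (int k - 2 - int b - int p) * h (int p - int y)) =
          (if int k - 2 - int b = int y then (-1) ^ y else 0)"
        by (rule convolution_window[OF h0(1) e0(1) conv]) (use b in auto)
      finally show ?thesis by (simp only: of_nat_eq_iff)
    qed
    show ?thesis
    proof (cases "c = k - 1")
      case True
      have "(\<Sum>p<k + l. G b p * F p c) = (\<Sum>p<k + l. G b p * h (int p - int c))"
        using True by (simp add: F_def)
      also have "\<dots> = 0" unfolding win using c True by auto
      finally show ?thesis .
    next
      case False
      then have "(\<Sum>p<k + l. G b p * F p c) = (\<Sum>p<k + l. G b p * h (int p - int c)) +
          (\<Sum>p<k + l. G b p * h (int p - int (2 * (k - 1) - c)))"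
        by (simp add: F_def algebra_simps sum.distrib)
      \<comment> \<open>Since \<open>c < k - 1\<close>, the index \<open>y = c\<close> can meet only
        the second delta of \<open>win\<close> and its reflection \<open>2 * (k - 1) - c\<close>
        only the first. Both are met exactly when b + c = k - 2, with equal parity, so they
        cancel.\<close>
      also have "\<dots> = (if b + k = 2 * (k - 1) - c then (-1) ^ (2 * (k - 1) - c) else 0) -
          (if int k - 2 - int b = int c then (-1) ^ c else 0)"
        unfolding win using c False by auto
      also have "\<dots> = 0"
      proof (cases "b + k = 2 * (k - 1) - c")
        case True
        then have "(-1 :: 'a) ^ (2 * (k - 1) - c) = (-1) ^ c"
          using c by (intro minus_one_power_iff[THEN trans] ) (auto simp: minus_one_power_iff)
        with True c show ?thesis by auto
      next
        case False
        with c show ?thesis by auto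
      qed
      finally show ?thesis .
    qed
  qed
  have YX: "Y * X = mat (k + l) (k + l) (\<lambda>(q, c). if q < k then X $$ (q, c)
      else if c < k then 0 else G (q - k) (t (c - k)))"
  proof (intro eq_matI, goal_cases)
    case (1 q c)
    then have "(Y * X) $$ (q, c) = (\<Sum>p<k + l. Y $$ (q, p) * X $$ (p, c))"
      by (simp add: X_def Y_def scalar_prod_def lessThan_atLeast0)
    also have "\<dots> = (if q < k then X $$ (q, c) else if c < k then 0 else G (q - k) (t (c - k)))"
    proof (cases "q < k")
      case True
      then have "(\<Sum>p<k + l. Y $$ (q, p) * X $$ (p, c)) = (\<Sum>p<k + l. if p = q then X $$ (p, c) else 0)"
        by (intro sum.cong) (auto simp: Y_def)
      with True show ?thesis by simp
    next
      case q: False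
      show ?thesis
      proof (cases "c < k")
        case True
        have "(\<Sum>p<k + l. Y $$ (q, p) * X $$ (p, c)) = (\<Sum>p<k + l. G (q - k) p * F p c)"
          using 1 q True by (intro sum.cong) (auto simp: X_def Y_def)
        with q True 1 show ?thesis by (simp add: GF)
      next
        case False
        have "(\<Sum>p<k + l. Y $$ (q, p) * X $$ (p, c)) =
            (\<Sum>p<k + l. if p = t (c - k) then G (q - k) p else 0)"
          using 1 q False by (intro sum.cong) (auto simp: X_def Y_def)
        with q False 1 t_less[of "c - k"] show ?thesis by simp
      qed
    qed
    finally show ?case using 1 by simp
  qed (auto simp: X_def Y_def)
  have detX: "det X = (sg * ck) * det (mat k k (\<lambda>(a, c). F (s a) c))"
  proof -
    have "det X = (\<Prod>b<l. (-1) ^ (t b + k + b)) * det (mat k k (\<lambda>(a, c). F (s a) c))"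
      unfolding X_def
    proof (rule det_unit_columns)
      show "strict_mono_on {..<k} s"
      proof (rule strict_mono_onI)
        fix a b assume ab: "a \<in> {..<k}" "b \<in> {..<k}" "a < b"
        then have "k - 1 - b < k - 1 - a" by auto
        with Lmono[of "k - 1 - b" "k - 1 - a"] ab show "s a < s b" by (simp add: s_def)
      qed
      show "strict_mono_on {..<l} t"
      proof (rule strict_mono_onI)
        fix a b assume "a \<in> {..<l}" "b \<in> {..<l}" "a < b"
        then show "t a < t b" using Mmono[of a b] Mle[of a] by (simp add: t_def)
      qed
      show "s ` {..<k} \<subseteq> {..<k + l}"
      proof
        fix x assume "x \<in> s ` {..<k}"
        then obtain a where "a < k" "x = s a" by auto
        then show "x \<in> {..<k + l}" using Lle[of "k - 1 - a"] by (simp add: s_def)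
      qed
      show "t ` {..<l} \<subseteq> {..<k + l}" using t_less by auto
      \<comment> \<open>By \<open>dual\<close>, \<open>s a\<close> exceeds \<open>t b\<close> if the
        cell in row \<open>k - 1 - a\<close> and column \<open>b\<close> belongs to the diagram, and
        is smaller otherwise.\<close>
      have "s a \<noteq> t b" if "a < k" "b < l" for a b
        using that dual[of "k - 1 - a" b] Mle[of b]
        by (cases "k - 1 - a < M b") (auto simp: s_def t_def)
      then show "s ` {..<k} \<inter> t ` {..<l} = {}" by auto
    qed
    then show ?thesis by (simp add: sg_def ck_def prod.distrib power_add mult_ac)
  qed
  have detY: "det Y = ck"
  proof -
    have "det Y = det (mat k k (\<lambda>(q, p). if p = q then 1 else 0)) *
        det (mat l l (\<lambda>(b, b'). G b (k + b')))"
      unfolding Y_def by (subst det_block_lower) (auto intro!: arg_cong2[of _ _ _ _ "(*)"] arg_cong[of _ _ det])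
    also have "det (mat k k (\<lambda>(q, p). if p = q then 1 else 0)) = (1 :: 'a)"
      by (subst det_lower_triangular_mat) auto
    also have "det (mat l l (\<lambda>(b, b'). G b (k + b'))) = ck"
      by (subst det_lower_triangular_mat) (auto simp: G_def e0 ck_def)
    finally show ?thesis by simp
  qed
  have "ck * det X = det (Y * X)"
    using det_mult[of Y "k + l" X] detY by (simp add: X_def Y_def)
  also have "\<dots> = det (mat k k (\<lambda>(q, c). F q c)) * det (mat l l (\<lambda>(b, b'). G b (t b')))"
    unfolding YX
    by (subst det_block_upper) (auto simp: X_def intro!: arg_cong2[of _ _ _ _ "(*)"] arg_cong[of _ _ det])
  also have "det (mat k k (\<lambda>(q, c). F q c)) = 1"
  proof -
    have "F i i = 1" if "i < k" for i
      using that h0(1)[of "int i - int (2 * (k - 1) - i)"] by (auto simp: F_def h0(2))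
    moreover have "F i j = 0" if "i < j" "j < k" for i j
      using that h0(1)[of "int i - int j"] h0(1)[of "int i - int (2 * (k - 1) - j)"]
      by (auto simp: F_def)
    ultimately show ?thesis by (subst det_lower_triangular_mat) auto
  qed
  \<comment> \<open>The parts \<open>M b'\<close> index columns here, so the orthogonal matrix
    appears transposed, with column \<open>b'\<close> scaled by \<open>(-1) ^ t b'\<close>.\<close>
  also have "det (mat l l (\<lambda>(b, b'). G b (t b'))) = sg * ?o"
  proof -
    let ?f = "\<lambda>(b, b'). e (int (M b') - int b' + int b) - e (int (M b') - int b' - int b - 2)"
    have "mat l l (\<lambda>(b, b'). G b (t b')) = mat l l (\<lambda>(b, b'). (-1) ^ t b' * ?f (b, b'))"
    proof (intro eq_matI, goal_cases)
      case (1 b b')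
      then have "int (t b') = int k + int b' - int (M b')"
        using Mle[of b'] by (simp add: t_def)
      then have "int (b + k) - int (t b') = int (M b') - int b' + int b"
        "int k - 2 - int b - int (t b') = int (M b') - int b' - int b - 2" by simp_all
      then have "G b (t b') = (-1) ^ t b' * ?f (b, b')"
        unfolding G_def by (simp only: prod.case)
      with 1 show ?case by simp
    qed auto
    then show ?thesis
      using det_scale_columns[of l "\<lambda>b. (-1) ^ t b" ?f] det_mat_transpose[of l ?f]
      by (simp add: sg_def)
  qed
  also have "det X = (sg * ck) * ?sp"
  proof -
    let ?g = "\<lambda>(a, c). if c = 0 then h (int (L a) - int a)
           else h (int (L a) - int a + int c) + h (int (L a) - int a - int c)"
    have "mat k k (\<lambda>(a, c). F (s a) c) = mat k k (\<lambda>(a, c). ?g (k - 1 - a, k - 1 - c))"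
      by (intro eq_matI) (auto simp: F_def s_def of_nat_diff algebra_simps)
    then show ?thesis using detX det_reverse[of k ?g] by simp
  qed
  finally have "(ck * ck) * sg * ?sp = sg * ?o" by (simp only: mult_ac mult_1 mult_1_right)
  moreover have "ck * ck = 1"
    by (simp add: ck_def prod.distrib[symmetric] power_mult_distrib[symmetric])
  moreover have "sg \<noteq> 0"
    by (simp add: sg_def)
  ultimately show ?thesis by simp
qed

section \<open>The involution on complete homogeneous functions\<close>

interpretation omega: comm_ring_hom omega
  by unfold_locales
    (simp_all add: omega_zero omega_add omega_mult omega_scalar[of 1, unfolded scalar_def, simplified])

interpretation scalar: comm_ring_hom scalar
  by unfold_locales (simp_all add: scalar_add scalar_mult, simp_all add: scalar_def)

section \<open>Signs in compositions of power series\<close>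

lemma omega_fps_power_nth:
  assumes "\<And>n. omega (fps_nth f n) = fps_nth g n"
  shows "omega (fps_nth (f ^ i) n) = fps_nth (g ^ i) n"
proof (induction i arbitrary: n)
  case (Suc i)
  then show ?case by (simp add: fps_mult_nth omega.hom_sum omega_mult assms)
qed simp

text \<open>Moves the sign from the inner series to the outer one, so that exp(-b) and exp(b) become
  compositions with the same inner series.\<close>

lemma fps_compose_uminus_power_nth:
  fixes a b :: "'a::comm_ring_1 fps"
  shows "fps_nth (a oo (- b)) n = fps_nth (Abs_fps (\<lambda>i. (-1) ^ i * fps_nth a i) oo b) n"
proof -
  have "(- b) ^ i = fps_const ((-1) ^ i) * b ^ i" for i
    by (subst power_minus) (simp add: fps_const_power[symmetric] fps_const_neg[symmetric])
  then show ?thesis by (simp add: fps_compose_nth mult_ac)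
qed

text \<open>The hypothesis means b'(z) = b(-z), a substitution compatible with powers.\<close>

lemma fps_power_alternating_nth:
  fixes b b' :: "'a::comm_ring_1 fps"
  assumes "\<And>n. fps_nth b' n = (-1) ^ n * fps_nth b n"
  shows "fps_nth (b' ^ i) n = (-1) ^ n * fps_nth (b ^ i) n"
proof (induction i arbitrary: n)
  case (Suc i)
  have "fps_nth (b' ^ Suc i) n = (\<Sum>j = 0..n. (-1) ^ j * (-1) ^ (n - j) * (fps_nth b j * fps_nth (b ^ i) (n - j)))"
    by (simp add: fps_mult_nth assms Suc mult_ac)
  also have "\<dots> = (\<Sum>j = 0..n. (-1) ^ n * (fps_nth b j * fps_nth (b ^ i) (n - j)))"
    by (intro sum.cong) (auto simp flip: power_add)
  finally show ?case by (simp add: fps_mult_nth sum_distrib_left)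
qed simp

text \<open>The identity exp(-z) exp(z) = 1 over the rationals, carried over coefficientwise along
  \<open>scalar\<close>.\<close>

lemma exp_series_inverse:
  "Abs_fps (\<lambda>k. (-1) ^ k * scalar (1 / fact k)) * Abs_fps (\<lambda>k. scalar (1 / fact k)) = 1"
proof (rule fps_ext)
  fix n
  have "(\<Sum>i = 0..n. (-1) ^ i / (fact i * fact (n - i))) = (if n = 0 then 1 else 0 :: rat)"
    using arg_cong[OF fps_exp_add_mult[of "-1 :: rat" 1], of "\<lambda>f. fps_nth f n"]
    by (simp add: fps_mult_nth)
  then have sum: "(\<Sum>i = 0..n. (-1) ^ i * ((1 / fact i) * (1 / fact (n - i)))) = (if n = 0 then 1 else 0 :: rat)"
    by simp
  have "(\<Sum>i = 0..n. (-1) ^ i * (scalar (1 / fact i) * scalar (1 / fact (n - i)))) =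
      scalar (\<Sum>i = 0..n. (-1) ^ i * ((1 / fact i) * (1 / fact (n - i))))"
    by (simp only: scalar.hom_sum scalar.hom_mult scalar.hom_power scalar.hom_uminus scalar.hom_one)
  also have "\<dots> = (if n = 0 then 1 else 0)" unfolding sum by simp
  finally show "fps_nth (Abs_fps (\<lambda>k. (-1) ^ k * scalar (1 / fact k)) * Abs_fps (\<lambda>k. scalar (1 / fact k))) n
      = fps_nth 1 n"
    by (simp add: fps_mult_nth mult.assoc)
qed

text \<open>With Q(z) = P(-z) one has H(-z) = exp(Q). Applying \<open>omega\<close> to the
  coefficients of P gives -Q, so H becomes exp(-Q). The claim compares coefficients in exp(Q)
  exp(-Q) = 1.\<close>

lemma complete_omega_convolution:
  "(\<Sum>i\<le>n. (-1) ^ i * complete (int i) * omega (complete (int n - int i))) = (if n = 0 then 1 else 0)"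
proof -
  define E where "E = Abs_fps (\<lambda>k. scalar (1 / fact k))"
  define E' where "E' = Abs_fps (\<lambda>k. (-1) ^ k * scalar (1 / fact k))"
  define P where "P = Abs_fps (\<lambda>n. if n = 0 then 0 else scalar (1 / of_nat n) * power_sum n)"
  define Q where "Q = Abs_fps (\<lambda>n. (-1) ^ n * fps_nth P n)"
  have H: "complete_series = E oo P" by (simp add: complete_series_def E_def P_def)
  have altH: "(-1) ^ i * complete (int i) = fps_nth (E oo Q) i" for i
  proof -
    have "fps_nth (Q ^ j) i = (-1) ^ i * fps_nth (P ^ j) i" for j
      by (rule fps_power_alternating_nth) (simp add: Q_def)
    then show ?thesis
      by (simp add: complete_def H fps_compose_nth sum_distrib_left mult_ac)
  qed
  have "omega (fps_nth P j) = fps_nth (- Q) j" for j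
    by (cases j) (simp_all add: P_def Q_def omega_zero omega_mult omega_scalar omega_power_sum)
  then have "omega (fps_nth (P ^ m) j) = fps_nth ((- Q) ^ m) j" for m j
    by (rule omega_fps_power_nth)
  then have "omega (complete (int j)) = fps_nth (E oo (- Q)) j" for j
    by (simp add: complete_def H fps_compose_nth omega.hom_sum omega_mult E_def omega_scalar)
  also have "fps_nth (E oo (- Q)) j = fps_nth (E' oo Q) j" for j
    by (simp add: fps_compose_uminus_power_nth E_def E'_def)
  finally have omegaH: "omega (complete (int j)) = fps_nth (E' oo Q) j" for j .
  have "(\<Sum>i\<le>n. (-1) ^ i * complete (int i) * omega (complete (int n - int i))) =
      (\<Sum>i = 0..n. fps_nth (E oo Q) i * fps_nth (E' oo Q) (n - i))"
    by (intro sum.cong) (auto simp: altH omegaH simp flip: of_nat_diff)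
  \<comment> \<open>Composition with \<open>Q\<close> is multiplicative because \<open>Q\<close> has
    zero constant term.\<close>
  also have "\<dots> = fps_nth ((E * E') oo Q) n"
    by (simp add: fps_mult_nth fps_compose_mult_distrib Q_def P_def)
  also have "E * E' = 1" using exp_series_inverse by (simp add: E_def E'_def mult.commute)
  finally show ?thesis by simp
qed

text \<open>Reversing the summation yields a factor \<open>(-1) ^ n\<close>, harmless because the
  right-hand side vanishes unless \<open>n = 0\<close>.\<close>

lemma alternating_convolution_swap:
  fixes f g :: "int \<Rightarrow> 'a::comm_ring_1"
  assumes "(\<Sum>i\<le>n. (-1) ^ i * f (int i) * g (int n - int i)) = (if n = 0 then 1 else 0)"
  shows "(\<Sum>i\<le>n. (-1) ^ i * g (int i) * f (int n - int i)) = (if n = 0 then 1 else 0)"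
proof -
  have "(\<Sum>i\<le>n. (-1) ^ i * g (int i) * f (int n - int i)) =
      (\<Sum>i\<le>n. (-1) ^ n * ((-1) ^ i * f (int i) * g (int n - int i)))"
    by (rule sum.reindex_bij_witness[of _ "\<lambda>i. n - i" "\<lambda>i. n - i"])
      (auto simp: of_nat_diff minus_one_power_iff)
  also have "\<dots> = (-1) ^ n * (if n = 0 then 1 else 0)"
    by (simp only: sum_distrib_left[symmetric] assms)
  finally show ?thesis by simp
qed

section \<open>Duality\<close>

text \<open>For j = 1 the two summands of an entry coincide, so the first column is doubled; this 2
  cancels the factor 1/2. The assumption ensures that this column exists.\<close>

lemma omega_sp_schur:
  assumes "lam \<noteq> []"
  shows "omega (sp_schur lam) = det (mat (length lam) (length lam) (\<lambda>(a, c).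
    if c = 0 then omega (complete (int (lam ! a) - int a))
    else omega (complete (int (lam ! a) - int a + int c)) + omega (complete (int (lam ! a) - int a - int c))))"
    (is "_ = det (mat ?k ?k ?f)")
proof -
  let ?c = "\<lambda>c. if c = 0 then 2 else 1 :: symfun"
  have "omega (sp_schur lam) = scalar (1 / 2) * det (mat ?k ?k (\<lambda>(a, c). ?c c * ?f (a, c)))"
    unfolding sp_schur_def omega_mult omega_scalar omega.hom_det[symmetric]
    by (intro arg_cong2[of _ _ _ _ "(*)"] arg_cong[of _ _ det] refl eq_matI)
      (auto simp: Let_def omega_add algebra_simps)
  also have "\<dots> = scalar (1 / 2) * (\<Prod>c<?k. ?c c) * det (mat ?k ?k ?f)"
    using det_scale_columns[of ?k ?c ?f] by (simp add: mult.assoc)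
  also have "(\<Prod>c<?k. ?c c) = 2" using assms by (simp add: prod.delta)
  also have "scalar (1 / 2) * 2 = 1"
    using scalar.hom_mult[of "1 / 2" 2] by (simp add: scalar_def)
  finally show ?thesis by simp
qed

lemma o_schur_altdef:
  "o_schur mu = det (mat (length mu) (length mu) (\<lambda>(a, b).
    complete (int (mu ! a) - int a + int b) - complete (int (mu ! a) - int a - int b - 2)))"
  unfolding o_schur_def
  by (intro arg_cong[of _ _ det] eq_matI) (auto simp: Let_def algebra_simps)

text \<open>As \<open>lam\<close> decreases, the rows of length greater than \<open>b\<close> form
  an initial segment, which contains \<open>a\<close> exactly when its size exceeds
  \<open>a\<close>. \<open>nth_default\<close> admits columns beyond the end of
  \<open>mu\<close>.\<close>

lemma conjugate_iff:
  assumes lam: "is_partition lam" and "is_conjugate mu lam" and a: "a < length lam"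
  shows "a < nth_default 0 mu b \<longleftrightarrow> b < lam ! a"
proof -
  let ?A = "{i. i < length lam \<and> lam ! i \<ge> b + 1}"
  have mu: "nth_default 0 mu b = card ?A" using assms(2) by (simp add: is_conjugate_def)
  have anti: "lam ! j \<le> lam ! i" if "i \<le> j" "j < length lam" for i j
    using lam that unfolding is_partition_def
    by (cases "i = j") (auto simp: sorted_wrt_iff_nth_less)
  show ?thesis
  proof
    assume "b < lam ! a"
    then have "{..a} \<subseteq> ?A" using anti[of _ a] a by fastforce
    from card_mono[OF _ this] show "a < nth_default 0 mu b" by (simp add: mu)
  next
    assume *: "a < nth_default 0 mu b"
    show "b < lam ! a"
    proof (rule ccontr)
      assume "\<not> b < lam ! a"
      then have "i < a" if "i \<in> ?A" for i
        using that anti[of a i] by (cases "a \<le> i") auto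
      then have "?A \<subseteq> {..<a}" by auto
      from card_mono[OF _ this] * show False by (simp add: mu)
    qed
  qed
qed

theorem theorem4p5:
  fixes lam mu :: "nat list"
  assumes "is_partition lam" and "is_partition mu" and "is_conjugate mu lam"
  shows "omega (sp_schur lam) = o_schur mu"
proof -
  have neg: "complete n = 0" if "n < 0" for n using that by (simp add: complete_def)
  have zero: "complete 0 = 1"
    by (simp add: complete_def complete_series_def)
  have iff: "a < mu ! b \<longleftrightarrow> b < lam ! a" if "a < length lam" "b < length mu" for a b
    using conjugate_iff[OF assms(1,3) that(1), of b] that(2) by (simp add: nth_default_def)
  have anti: "xs ! b \<le> xs ! a" if "is_partition xs" "a < b" "b < length xs" for xs :: "nat list" and a b
    using that by (auto simp: is_partition_def sorted_wrt_iff_nth_less)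
  \<comment> \<open>At column \<open>length mu\<close> the default part is 0, so no row of
    \<open>lam\<close> reaches beyond it.\<close>
  have "lam ! a \<le> length mu" if "a < length lam" for a
    using conjugate_iff[OF assms(1,3) that, of "length mu"] by (simp add: nth_default_def)
  moreover have "mu ! b \<le> length lam" if "b < length mu" for b
  proof -
    have "mu ! b = card {i. i < length lam \<and> lam ! i \<ge> b + 1}"
      using assms(3) that by (metis is_conjugate_def nth_default_nth)
    also have "\<dots> \<le> card {..<length lam}" by (rule card_mono) auto
    finally show ?thesis by simp
  qed
  ultimately show ?thesis
    unfolding omega_sp_schur[OF assms(1)[unfolded is_partition_def, THEN conjunct1]] o_schur_altdef
    \<comment> \<open>The roles are exchanged: \<open>h\<close> becomes the image of
      \<open>complete\<close> under \<open>omega\<close>, and \<open>e\<close> becomes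
      \<open>complete\<close> itself.\<close>
    by (intro symplectic_orthogonal_det[where h = "\<lambda>n. omega (complete n)"]
        alternating_convolution_swap[OF complete_omega_convolution])
      (auto simp: neg zero omega_zero iff anti[OF assms(1)] anti[OF assms(2)])
qed

end
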